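(* Let $\Lambda$ be a lattice with $\Lambda_R\subseteq\Lambda\subseteq\Lambda_W$ and let $\Lambda'\subseteq\operatorname{Cent}_{\Lambda_R}(\Lambda_R)$ be a sublattice of finite index. Let $H_1,H_2$ be subgroups of $\Lambda/\Lambda_R$ with $|H_1|=|H_2|$, let $\Lambda_i\subseteq\Lambda$ be the preimage of $H_i$, and let $g\colon H_1\times H_2\to\mathbb C^\times$ be a pairing of groups such that $\hat f(\mu,\nu)=q^{-(\mu,\nu)}g(\bar\mu,\bar\nu)$ is a well-defined pairing $\Lambda_1/\Lambda'\times\Lambda_2/\Lambda'\to\mathbb C^\times$. If $\hat f$ is perfect, then $$\operatorname{Cent}_{\Lambda_R}(\Lambda_1)=\operatorname{Cent}_{\Lambda_R}(\Lambda_2)=\Lambda'.$$ In particular $\Lambda'$ is uniquely determined.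
   Context: Let $\mathfrak g$ be a finite-dimensional simple complex Lie algebra with simple roots $\alpha_1,\dots,\alpha_n$, and $(\cdot,\cdot)$ the invariant bilinear form normalized so that short roots satisfy $(\alpha,\alpha)=2$; $d_i=(\alpha_i,\alpha_i)/2$. $\Lambda_R$ is the root lattice, $\Lambda_W$ the weight lattice spanned by the $\lambda_i$ with $(\lambda_i,\alpha_j)=\delta_{ij}d_i$. Let $\ell\ge1$ be an integer, $q=\exp(2\pi i/\ell)$ and $q^r:=\exp(2\pi i r/\ell)$ for $r\in\mathbb Q$. For lattices $A,B$ put $\operatorname{Cent}_A(B)=\{\nu\in A\mid(\nu,\mu)\in\ell\mathbb Z\ \forall\mu\in B\}$. A bar denotes the class in $\Lambda/\Lambda_R$. A pairing of finite abelian groups $A\times B\to\mathbb C^\times$ (multiplicative in each argument) is perfect if no non-zero element of $A$ pairs trivially with all of $B$ and no non-zero element of $B$ pairs trivially with all of $A$. *)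

theory Defs
  imports Complex_Main "HOL-Algebra.Coset"
begin

section \<open>Simple complex Lie algebras\<close>

locale lie_algebra = vector_space scl
  for scl :: "complex \<Rightarrow> 'g::ab_group_add \<Rightarrow> 'g" +
  fixes brk :: "'g \<Rightarrow> 'g \<Rightarrow> 'g"
  assumes brk_linear_left: "Vector_Spaces.linear scl scl (\<lambda>x. brk x y)"
    and brk_linear_right: "Vector_Spaces.linear scl scl (brk x)"
    and brk_self: "brk x x = 0"
    and jacobi: "brk x (brk y z) + brk y (brk z x) + brk z (brk x y) = 0"
begin

definition lie_ideal :: "'g set \<Rightarrow> bool" where
  "lie_ideal I \<longleftrightarrow> subspace I \<and> (\<forall>x. \<forall>y\<in>I. brk x y \<in> I)"

definition subalgebra :: "'g set \<Rightarrow> bool" where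
  "subalgebra S \<longleftrightarrow> subspace S \<and> (\<forall>x\<in>S. \<forall>y\<in>S. brk x y \<in> S)"

primrec lower_central :: "'g set \<Rightarrow> nat \<Rightarrow> 'g set" where
  "lower_central S 0 = S"
| "lower_central S (Suc k) = span {brk x y | x y. x \<in> S \<and> y \<in> lower_central S k}"

definition nilpotent :: "'g set \<Rightarrow> bool" where
  "nilpotent S \<longleftrightarrow> (\<exists>k. lower_central S k = {0})"

definition normalizer :: "'g set \<Rightarrow> 'g set" where
  "normalizer S = {x. \<forall>y\<in>S. brk x y \<in> S}"

definition cartan_subalgebra :: "'g set \<Rightarrow> bool" where
  "cartan_subalgebra H \<longleftrightarrow> subalgebra H \<and> nilpotent H \<and> normalizer H = H"

definition invariant_form :: "('g \<Rightarrow> 'g \<Rightarrow> complex) \<Rightarrow> bool" where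
  "invariant_form \<kappa> \<longleftrightarrow>
     (\<forall>x. Vector_Spaces.linear scl (*) (\<kappa> x)) \<and>
     (\<forall>x y. \<kappa> x y = \<kappa> y x) \<and>
     (\<forall>x y z. \<kappa> (brk x y) z = \<kappa> x (brk y z)) \<and>
     (\<forall>x. (\<forall>y. \<kappa> x y = 0) \<longrightarrow> x = 0)"

end

locale simple_lie_algebra = lie_algebra +
  assumes finite_dim: "\<exists>B. finite B \<and> span B = UNIV"
    and nonabelian: "\<exists>x y. brk x y \<noteq> 0"
    and simple: "lie_ideal I \<Longrightarrow> I = {0} \<or> I = UNIV"


section \<open>Roots\<close>

text \<open>The dual of a subspace \<open>H\<close>: functions that are linear on \<open>H\<close>, extended by zero
  outside \<open>H\<close> so that equal functionals are equal as functions.\<close>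

definition dual :: "(complex \<Rightarrow> 'g::ab_group_add \<Rightarrow> 'g) \<Rightarrow> 'g set \<Rightarrow> ('g \<Rightarrow> complex) set" where
  "dual scl H = {f. (\<forall>x\<in>H. \<forall>y\<in>H. f (x + y) = f x + f y) \<and>
                    (\<forall>c. \<forall>x\<in>H. f (scl c x) = c * f x) \<and>
                    (\<forall>x. x \<notin> H \<longrightarrow> f x = 0)}"

text \<open>The additive group of the dual, in the multiplicative notation of HOL-Algebra.\<close>

definition dual_group ::
  "(complex \<Rightarrow> 'g::ab_group_add \<Rightarrow> 'g) \<Rightarrow> 'g set \<Rightarrow> ('g \<Rightarrow> complex) monoid" where
  "dual_group scl H =
     \<lparr>carrier = dual scl H, mult = (\<lambda>\<mu> \<nu> x. \<mu> x + \<nu> x), one = (\<lambda>_. 0)\<rparr>"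

definition root_space ::
  "(complex \<Rightarrow> 'g \<Rightarrow> 'g) \<Rightarrow> ('g \<Rightarrow> 'g \<Rightarrow> 'g) \<Rightarrow> 'g set \<Rightarrow> ('g \<Rightarrow> complex) \<Rightarrow> 'g set" where
  "root_space scl brk H \<beta> = {x. \<forall>h\<in>H. brk h x = scl (\<beta> h) x}"

definition roots :: "(complex \<Rightarrow> 'g::ab_group_add \<Rightarrow> 'g) \<Rightarrow> ('g \<Rightarrow> 'g \<Rightarrow> 'g) \<Rightarrow> 'g set \<Rightarrow>
    ('g \<Rightarrow> complex) set" where
  "roots scl brk H = {\<beta> \<in> dual scl H. \<beta> \<noteq> (\<lambda>_. 0) \<and> root_space scl brk H \<beta> \<noteq> {0}}"

definition simple_roots :: "(complex \<Rightarrow> 'g::ab_group_add \<Rightarrow> 'g) \<Rightarrow> ('g \<Rightarrow> 'g \<Rightarrow> 'g) \<Rightarrow> 'g set \<Rightarrow>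
    nat \<Rightarrow> (nat \<Rightarrow> 'g \<Rightarrow> complex) \<Rightarrow> bool" where
  "simple_roots scl brk H n \<alpha> \<longleftrightarrow>
     \<alpha> ` {1..n} \<subseteq> roots scl brk H \<and>
     (\<forall>c. (\<forall>h. (\<Sum>i=1..n. c i * \<alpha> i h) = 0) \<longrightarrow> (\<forall>i\<in>{1..n}. c i = 0)) \<and>
     (\<forall>\<beta>\<in>roots scl brk H. \<exists>k::nat \<Rightarrow> nat.
        \<beta> = (\<lambda>h. \<Sum>i=1..n. of_nat (k i) * \<alpha> i h) \<or>
        \<beta> = (\<lambda>h. - (\<Sum>i=1..n. of_nat (k i) * \<alpha> i h)))"


section \<open>The form on the dual of a Cartan subalgebra\<close>

text \<open>An invariant form \<open>\<kappa>\<close> is transported to the dual of \<open>H\<close> along the isomorphism that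
  sends \<open>t \<in> H\<close> to the functional \<open>\<kappa> t\<close> on \<open>H\<close>.\<close>

definition dual_form ::
  "('g \<Rightarrow> 'g \<Rightarrow> complex) \<Rightarrow> 'g set \<Rightarrow> ('g \<Rightarrow> complex) \<Rightarrow> ('g \<Rightarrow> complex) \<Rightarrow> complex" where
  "dual_form \<kappa> H \<mu> \<nu> =
     (let t = (\<lambda>\<xi>. THE t. t \<in> H \<and> (\<forall>h\<in>H. \<kappa> t h = \<xi> h)) in \<kappa> (t \<mu>) (t \<nu>))"

text \<open>An invariant form on a simple Lie algebra is a complex multiple of the Killing form,
  which is real and positive on roots. Hence comparing moduli selects the shortest roots
  whatever the multiple is. In the simply-laced case all roots are short.\<close>

definition short_roots :: "(complex \<Rightarrow> 'g::ab_group_add \<Rightarrow> 'g) \<Rightarrow> ('g \<Rightarrow> 'g \<Rightarrow> 'g) \<Rightarrow> 'g set \<Rightarrow>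
    ('g \<Rightarrow> 'g \<Rightarrow> complex) \<Rightarrow> ('g \<Rightarrow> complex) set" where
  "short_roots scl brk H \<kappa> = {\<alpha> \<in> roots scl brk H. \<forall>\<beta>\<in>roots scl brk H.
     cmod (dual_form \<kappa> H \<alpha> \<alpha>) \<le> cmod (dual_form \<kappa> H \<beta> \<beta>)}"

text \<open>\<open>\<alpha> 1, \<dots>, \<alpha> n\<close> are the simple roots and \<open>\<omega> 1, \<dots>, \<omega> n\<close> the fundamental weights.\<close>

locale normalized_simple_lie_algebra = simple_lie_algebra scl brk
  for scl :: "complex \<Rightarrow> 'g::ab_group_add \<Rightarrow> 'g" and brk +
  fixes H :: "'g set" and \<kappa> :: "'g \<Rightarrow> 'g \<Rightarrow> complex"
    and n :: nat and \<alpha> \<omega> :: "nat \<Rightarrow> 'g \<Rightarrow> complex"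
  assumes cartan: "cartan_subalgebra H"
    and invariant: "invariant_form \<kappa>"
    and normalized: "\<beta> \<in> short_roots scl brk H \<kappa> \<Longrightarrow> dual_form \<kappa> H \<beta> \<beta> = 2"
    and simple_roots: "simple_roots scl brk H n \<alpha>"
    and weight_in_dual: "i \<in> {1..n} \<Longrightarrow> \<omega> i \<in> dual scl H"
    and weight: "i \<in> {1..n} \<Longrightarrow> j \<in> {1..n} \<Longrightarrow>
      dual_form \<kappa> H (\<omega> i) (\<alpha> j) = (if i = j then dual_form \<kappa> H (\<alpha> i) (\<alpha> i) / 2 else 0)"


section \<open>Lattices and pairings\<close>

definition int_span :: "nat \<Rightarrow> (nat \<Rightarrow> 'g \<Rightarrow> complex) \<Rightarrow> ('g \<Rightarrow> complex) set" where
  "int_span n v = {\<mu>. \<exists>k::nat \<Rightarrow> int. \<mu> = (\<lambda>h. \<Sum>i=1..n. of_int (k i) * v i h)}"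

definition Cent :: "('v \<Rightarrow> 'v \<Rightarrow> complex) \<Rightarrow> nat \<Rightarrow> 'v set \<Rightarrow> 'v set \<Rightarrow> 'v set" where
  "Cent form l A B = {\<nu> \<in> A. \<forall>\<mu>\<in>B. \<exists>k::int. form \<nu> \<mu> = of_int (int l * k)}"

text \<open>The power \<open>q\<^sup>r\<close> of \<open>q = exp (2\<pi>\<i>/l)\<close>. The exponents that occur are rational, but the
  form takes its values in the complex numbers.\<close>

definition qpow :: "nat \<Rightarrow> complex \<Rightarrow> complex" where
  "qpow l r = exp (2 * of_real pi * \<i> * r / of_nat l)"

definition quotient_group :: "('v, 'm) monoid_scheme \<Rightarrow> 'v set \<Rightarrow> 'v set \<Rightarrow> 'v set monoid" where
  "quotient_group G A B = (G\<lparr>carrier := A\<rparr>) Mod B"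

definition preimage :: "('v, 'm) monoid_scheme \<Rightarrow> 'v set \<Rightarrow> 'v set \<Rightarrow> 'v set set \<Rightarrow> 'v set" where
  "preimage G A B S = {\<mu> \<in> A. B #>\<^bsub>G\<^esub> \<mu> \<in> S}"

definition finite_index_subgroup :: "('v, 'm) monoid_scheme \<Rightarrow> 'v set \<Rightarrow> 'v set \<Rightarrow> bool" where
  "finite_index_subgroup G B A \<longleftrightarrow>
     subgroup B G \<and> B \<subseteq> A \<and> finite {B #>\<^bsub>G\<^esub> a | a. a \<in> A}"

definition pairing ::
  "('a, 'm) monoid_scheme \<Rightarrow> ('b, 'k) monoid_scheme \<Rightarrow> ('a \<Rightarrow> 'b \<Rightarrow> complex) \<Rightarrow> bool" where
  "pairing A B f \<longleftrightarrow>
     (\<forall>a\<in>carrier A. \<forall>b\<in>carrier B. f a b \<noteq> 0) \<and>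
     (\<forall>a\<in>carrier A. \<forall>a'\<in>carrier A. \<forall>b\<in>carrier B. f (a \<otimes>\<^bsub>A\<^esub> a') b = f a b * f a' b) \<and>
     (\<forall>a\<in>carrier A. \<forall>b\<in>carrier B. \<forall>b'\<in>carrier B. f a (b \<otimes>\<^bsub>B\<^esub> b') = f a b * f a b')"

definition perfect ::
  "('a, 'm) monoid_scheme \<Rightarrow> ('b, 'k) monoid_scheme \<Rightarrow> ('a \<Rightarrow> 'b \<Rightarrow> complex) \<Rightarrow> bool" where
  "perfect A B f \<longleftrightarrow>
     (\<forall>a\<in>carrier A. (\<forall>b\<in>carrier B. f a b = 1) \<longrightarrow> a = \<one>\<^bsub>A\<^esub>) \<and>
     (\<forall>b\<in>carrier B. (\<forall>a\<in>carrier A. f a b = 1) \<longrightarrow> b = \<one>\<^bsub>B\<^esub>)"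

text \<open>\<open>fhat\<close> is a function of classes modulo \<open>L'\<close>, prescribed on representatives \<open>\<mu>\<close>, \<open>\<nu>\<close>.
  The existence of such an \<open>fhat\<close> is the well-definedness of the prescription.\<close>

definition induced_by ::
  "('v, 'm) monoid_scheme \<Rightarrow> ('v \<Rightarrow> 'v \<Rightarrow> complex) \<Rightarrow> nat \<Rightarrow> 'v set \<Rightarrow> 'v set \<Rightarrow> 'v set \<Rightarrow> 'v set \<Rightarrow>
    ('v set \<Rightarrow> 'v set \<Rightarrow> complex) \<Rightarrow> ('v set \<Rightarrow> 'v set \<Rightarrow> complex) \<Rightarrow> bool" where
  "induced_by G form l R L1 L2 L' g fhat \<longleftrightarrow>
     (\<forall>\<mu>\<in>L1. \<forall>\<nu>\<in>L2. fhat (L' #>\<^bsub>G\<^esub> \<mu>) (L' #>\<^bsub>G\<^esub> \<nu>) =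
        qpow l (- form \<mu> \<nu>) * g (R #>\<^bsub>G\<^esub> \<mu>) (R #>\<^bsub>G\<^esub> \<nu>))"

end

theory Submission
  imports Defs "HOL-Analysis.Complex_Transcendental"
begin

text \<open>
  Both inclusions are read off from the values of \<open>fhat\<close> on classes of elements of \<open>L1\<close> and of
  \<open>R\<close>. An element of \<open>R\<close> has trivial class in \<open>L / R\<close>, so the factor \<open>g\<close> is \<open>1\<close> there, and \<open>fhat\<close>
  on the classes of \<open>\<mu> \<in> L1\<close> and \<open>\<nu> \<in> R\<close> is \<open>qpow l (- form \<mu> \<nu>)\<close>. This number is \<open>1\<close> exactly
  when \<open>form \<mu> \<nu>\<close> is an integer multiple of \<open>l\<close>. Consequently an element \<open>\<nu>\<close> of \<open>R\<close> lies in
  \<open>Cent form l R L1\<close> if and only if its class modulo \<open>L'\<close> pairs trivially with the whole of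
  \<open>L1 / L'\<close>. Elements of \<open>L'\<close> have trivial class and so pair trivially; conversely, perfectness
  forces the class of a trivially pairing \<open>\<nu>\<close> to vanish, that is, \<open>\<nu> \<in> L'\<close>. This is
  \<open>Cent_eq_of_perfect\<close>.

  The statement for \<open>L2\<close> is the same one applied to the transposed pairings, which satisfy the
  same conditions because the form is symmetric. Since the two centralizers do not involve \<open>L'\<close>,
  uniqueness follows.
\<close>

lemma group_dual_group: "group (dual_group scl H)"
proof (rule groupI)
  fix \<mu> assume "\<mu> \<in> carrier (dual_group scl H)"
  then have "(\<lambda>x. - \<mu> x) \<in> carrier (dual_group scl H)"
    by (auto simp: dual_group_def dual_def)
  moreover have "(\<lambda>x. - \<mu> x) \<otimes>\<^bsub>dual_group scl H\<^esub> \<mu> = \<one>\<^bsub>dual_group scl H\<^esub>"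
    by (simp add: dual_group_def)
  ultimately show "\<exists>\<nu>\<in>carrier (dual_group scl H). \<nu> \<otimes>\<^bsub>dual_group scl H\<^esub> \<mu> = \<one>\<^bsub>dual_group scl H\<^esub>"
    by blast
qed (auto simp: dual_group_def dual_def algebra_simps)

lemma int_span_diff:
  assumes "\<mu> \<in> int_span n v" "\<nu> \<in> int_span n v"
  shows "(\<lambda>h. \<mu> h - \<nu> h) \<in> int_span n v"
proof -
  obtain a b :: "nat \<Rightarrow> int" where "\<mu> = (\<lambda>h. \<Sum>i=1..n. of_int (a i) * v i h)"
    and "\<nu> = (\<lambda>h. \<Sum>i=1..n. of_int (b i) * v i h)"
    using assms by (auto simp: int_span_def)
  then have "(\<lambda>h. \<mu> h - \<nu> h) = (\<lambda>h. \<Sum>i=1..n. of_int (a i - b i) * v i h)"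
    by (simp add: sum_subtractf left_diff_distrib)
  then show ?thesis
    unfolding int_span_def by (intro CollectI exI[of _ "\<lambda>i. a i - b i"])
qed

lemma subgroup_int_span:
  assumes sub: "int_span n v \<subseteq> carrier (dual_group scl H)"
  shows "subgroup (int_span n v) (dual_group scl H)"
proof -
  interpret group "dual_group scl H" by (rule group_dual_group)
  have zero: "(\<lambda>_. 0) \<in> int_span n v"
    unfolding int_span_def by (intro CollectI exI[of _ "\<lambda>_. 0"]) simp
  have neg: "(\<lambda>h. - \<mu> h) \<in> int_span n v" if "\<mu> \<in> int_span n v" for \<mu>
    using int_span_diff[OF zero that] by simp
  have inv: "inv\<^bsub>dual_group scl H\<^esub> \<mu> = (\<lambda>h. - \<mu> h)" if "\<mu> \<in> int_span n v" for \<mu>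
    by (rule inv_equality) (use that sub neg in \<open>auto simp: dual_group_def\<close>)
  show ?thesis
  proof (rule subgroupI[OF sub])
    fix \<mu> \<nu> assume \<mu>: "\<mu> \<in> int_span n v" and \<nu>: "\<nu> \<in> int_span n v"
    show "inv\<^bsub>dual_group scl H\<^esub> \<mu> \<in> int_span n v"
      using inv neg \<mu> by simp
    show "\<mu> \<otimes>\<^bsub>dual_group scl H\<^esub> \<nu> \<in> int_span n v"
      using int_span_diff[OF \<mu> neg[OF \<nu>]] by (simp add: dual_group_def)
  qed (use zero in blast)
qed

lemma (in lie_algebra) dual_form_commute:
  assumes "invariant_form \<kappa>"
  shows "dual_form \<kappa> H \<mu> \<nu> = dual_form \<kappa> H \<nu> \<mu>"
  using assms by (simp add: dual_form_def invariant_form_def Let_def)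

lemma qpow_minus_eq_1_iff:
  assumes "l \<ge> 1"
  shows "qpow l (- r) = 1 \<longleftrightarrow> (\<exists>k::int. r = of_int (int l * k))"
proof -
  have "qpow l (- r) = 1 \<longleftrightarrow> qpow l r = 1"
    by (simp add: qpow_def exp_minus)
  also have "\<dots> \<longleftrightarrow> (\<exists>k::int. 2 * of_real pi * \<i> * r / of_nat l = 2 * of_int k * of_real pi * \<i>)"
    using exp_eq[of "2 * of_real pi * \<i> * r / of_nat l" 0] by (simp add: qpow_def)
  also have "\<dots> \<longleftrightarrow> (\<exists>k::int. r = of_int (int l * k))"
    using assms by (intro ex_cong1) (auto simp: field_simps)
  finally show ?thesis .
qed

lemma pairing_one_right:
  assumes "pairing A B f" "a \<in> carrier A" "\<one>\<^bsub>B\<^esub> \<in> carrier B" "\<one>\<^bsub>B\<^esub> \<otimes>\<^bsub>B\<^esub> \<one>\<^bsub>B\<^esub> = \<one>\<^bsub>B\<^esub>"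
  shows "f a \<one>\<^bsub>B\<^esub> = 1"
proof -
  have "f a \<one>\<^bsub>B\<^esub> = f a \<one>\<^bsub>B\<^esub> * f a \<one>\<^bsub>B\<^esub>" and "f a \<one>\<^bsub>B\<^esub> \<noteq> 0"
    using assms unfolding pairing_def by metis+
  then show ?thesis by simp
qed

lemma carrier_quotient_group: "carrier (quotient_group G A B) = {B #>\<^bsub>G\<^esub> a | a. a \<in> A}"
  by (auto simp: quotient_group_def FactGroup_def RCOSETS_def r_coset_def)

lemma one_quotient_group: "\<one>\<^bsub>quotient_group G A B\<^esub> = B"
  by (simp add: quotient_group_def FactGroup_def)

lemma mult_quotient_group: "x \<otimes>\<^bsub>quotient_group G A B\<^esub> y = x <#>\<^bsub>G\<^esub> y"
  by (simp add: quotient_group_def FactGroup_def set_mult_def)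

lemma pairing_swap: "pairing A B f \<Longrightarrow> pairing B A (\<lambda>b a. f a b)"
  by (simp add: pairing_def)

lemma perfect_swap: "perfect A B f \<Longrightarrow> perfect B A (\<lambda>b a. f a b)"
  by (simp add: perfect_def)

lemma induced_by_swap:
  assumes "\<And>\<mu> \<nu>. form \<mu> \<nu> = form \<nu> \<mu>" "induced_by G form l R L1 L2 L' g fhat"
  shows "induced_by G form l R L2 L1 L' (\<lambda>b a. g a b) (\<lambda>b a. fhat a b)"
  using assms by (simp add: induced_by_def)

text \<open>
  For \<open>\<nu> \<in> R\<close> the prescription of \<open>fhat\<close> loses its factor \<open>g\<close>, so that membership of \<open>\<nu>\<close> in the
  centralizer means that the class of \<open>\<nu>\<close> modulo \<open>L'\<close> pairs trivially with \<open>L1 / L'\<close>. Perfectness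
  says that only the class \<open>L'\<close> does so.
\<close>

lemma Cent_eq_of_perfect:
  fixes G (structure)
  assumes "group G" and commute: "\<And>\<mu> \<nu>. form \<mu> \<nu> = form \<nu> \<mu>" and l: "l \<ge> 1"
    and R: "subgroup R G" "R \<subseteq> L" and L: "L \<subseteq> carrier G"
    and L': "subgroup L' G" "L' \<subseteq> R"
    and RH: "R \<in> H2"
    and L1: "L1 = preimage G L R H1" and L2: "L2 = preimage G L R H2"
    and g: "pairing ((quotient_group G L R)\<lparr>carrier := H1\<rparr>) ((quotient_group G L R)\<lparr>carrier := H2\<rparr>) g"
    and ind: "induced_by G form l R L1 L2 L' g fhat"
    and f: "pairing (quotient_group G L1 L') (quotient_group G L2 L') fhat"
    and perf: "perfect (quotient_group G L1 L') (quotient_group G L2 L') fhat"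
  shows "Cent form l R L1 = L'"
proof -
  interpret group G by fact
  have R_sub: "R \<subseteq> L2"
    using R RH L coset_join2[OF _ R(1)] by (auto simp: L2 preimage_def)
  have f_R: "fhat (L' #> \<mu>) (L' #> \<nu>) = qpow l (- form \<mu> \<nu>)" if "\<mu> \<in> L1" "\<nu> \<in> R" for \<mu> \<nu>
  proof -
    have "g (R #> \<mu>) R = 1"
      using pairing_one_right[OF g, of "R #> \<mu>"] that(1) RH subgroup_mult_id[OF R(1)]
      by (simp add: one_quotient_group mult_quotient_group L1 preimage_def)
    moreover have "R #> \<nu> = R"
      using that(2) R L by (intro coset_join2) auto
    ultimately show ?thesis
      using ind that R_sub by (auto simp: induced_by_def)
  qed
  have Cent_iff: "\<nu> \<in> Cent form l R L1 \<longleftrightarrow> (\<forall>\<mu>\<in>L1. fhat (L' #> \<mu>) (L' #> \<nu>) = 1)"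
    if "\<nu> \<in> R" for \<nu>
    using that by (simp add: Cent_def f_R qpow_minus_eq_1_iff[OF l] commute[of \<nu>])
  show ?thesis
  proof (intro equalityI subsetI)
    fix \<nu> assume \<nu>: "\<nu> \<in> Cent form l R L1"
    then have "\<nu> \<in> R" by (simp add: Cent_def)
    have "\<forall>a \<in> carrier (quotient_group G L1 L'). fhat a (L' #> \<nu>) = 1"
      using \<nu> Cent_iff[OF \<open>\<nu> \<in> R\<close>] by (auto simp: carrier_quotient_group)
    moreover have "L' #> \<nu> \<in> carrier (quotient_group G L2 L')"
      using \<open>\<nu> \<in> R\<close> R_sub by (auto simp: carrier_quotient_group)
    ultimately have "L' #> \<nu> = L'"
      using perf by (simp add: perfect_def one_quotient_group)
    then show "\<nu> \<in> L'"
      using coset_join1 \<open>\<nu> \<in> R\<close> R L L'(1) by blast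
  next
    fix \<nu> assume "\<nu> \<in> L'"
    then have "\<nu> \<in> R"
      using L'(2) by blast
    then have "L' #> \<nu> = L'"
      using coset_join2 \<open>\<nu> \<in> L'\<close> L'(1) R(2) L by blast
    with \<open>\<nu> \<in> R\<close> have "L' \<in> carrier (quotient_group G L2 L')"
      using R_sub by (auto simp: carrier_quotient_group)
    then have "fhat (L' #> \<mu>) L' = 1" if "\<mu> \<in> L1" for \<mu>
      using pairing_one_right[OF f, of "L' #> \<mu>"] that subgroup_mult_id[OF L'(1)]
      by (auto simp: one_quotient_group mult_quotient_group carrier_quotient_group)
    then show "\<nu> \<in> Cent form l R L1"
      using Cent_iff[OF \<open>\<nu> \<in> R\<close>] \<open>L' #> \<nu> = L'\<close> by simp
  qed
qed

theorem corollary3p6: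
  fixes scl :: "complex \<Rightarrow> 'g::ab_group_add \<Rightarrow> 'g" and brk :: "'g \<Rightarrow> 'g \<Rightarrow> 'g"
    and H :: "'g set" and \<kappa> :: "'g \<Rightarrow> 'g \<Rightarrow> complex"
    and n l :: nat and \<alpha> \<omega> :: "nat \<Rightarrow> 'g \<Rightarrow> complex"
    and G :: "('g \<Rightarrow> complex) monoid" and form :: "('g \<Rightarrow> complex) \<Rightarrow> ('g \<Rightarrow> complex) \<Rightarrow> complex"
    and R W L L' L1 L2 :: "('g \<Rightarrow> complex) set" and H1 H2 :: "('g \<Rightarrow> complex) set set"
    and g fhat :: "('g \<Rightarrow> complex) set \<Rightarrow> ('g \<Rightarrow> complex) set \<Rightarrow> complex"
  assumes "normalized_simple_lie_algebra scl brk H \<kappa> n \<alpha> \<omega>"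
    and "G = dual_group scl H" and "form = dual_form \<kappa> H"
    and "R = int_span n \<alpha>" and "W = int_span n \<omega>"
    and "l \<ge> 1"
    and "subgroup L G" and "R \<subseteq> L" and "L \<subseteq> W"
    and "finite_index_subgroup G L' (Cent form l R R)"
    and "subgroup H1 (quotient_group G L R)" and "subgroup H2 (quotient_group G L R)"
    and "card H1 = card H2"
    and "L1 = preimage G L R H1" and "L2 = preimage G L R H2"
    and "pairing ((quotient_group G L R)\<lparr>carrier := H1\<rparr>) ((quotient_group G L R)\<lparr>carrier := H2\<rparr>) g"
    and "induced_by G form l R L1 L2 L' g fhat"
    and "pairing (quotient_group G L1 L') (quotient_group G L2 L') fhat"
    and "perfect (quotient_group G L1 L') (quotient_group G L2 L') fhat"
  shows "Cent form l R L1 = L' \<and> Cent form l R L2 = L' \<and>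
    (\<forall>M' g' fhat'.
       finite_index_subgroup G M' (Cent form l R R) \<longrightarrow>
       pairing ((quotient_group G L R)\<lparr>carrier := H1\<rparr>) ((quotient_group G L R)\<lparr>carrier := H2\<rparr>) g' \<longrightarrow>
       induced_by G form l R L1 L2 M' g' fhat' \<longrightarrow>
       pairing (quotient_group G L1 M') (quotient_group G L2 M') fhat' \<longrightarrow>
       perfect (quotient_group G L1 M') (quotient_group G L2 M') fhat' \<longrightarrow>
       M' = L')"
proof -
  interpret normalized_simple_lie_algebra scl brk H \<kappa> n \<alpha> \<omega> by fact
  have G: "group G"
    unfolding assms(2) by (rule group_dual_group)
  have commute: "form \<mu> \<nu> = form \<nu> \<mu>" for \<mu> \<nu>
    unfolding assms(3) by (rule dual_form_commute[OF invariant])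
  have L: "L \<subseteq> carrier G"
    using \<open>subgroup L G\<close> by (rule subgroup.subset)
  have R: "subgroup R G"
    using L \<open>R \<subseteq> L\<close> unfolding assms(2,4) by (intro subgroup_int_span) blast
  have RH: "R \<in> H1" "R \<in> H2"
    using subgroup.one_closed[OF assms(11)] subgroup.one_closed[OF assms(12)]
    by (simp_all add: one_quotient_group)
  have both: "Cent form l R L1 = M \<and> Cent form l R L2 = M"
    if M: "finite_index_subgroup G M (Cent form l R R)"
      and g: "pairing ((quotient_group G L R)\<lparr>carrier := H1\<rparr>) ((quotient_group G L R)\<lparr>carrier := H2\<rparr>) g"
      and ind: "induced_by G form l R L1 L2 M g fhat"
      and f: "pairing (quotient_group G L1 M) (quotient_group G L2 M) fhat"
      and perf: "perfect (quotient_group G L1 M) (quotient_group G L2 M) fhat"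
    for M g fhat
  proof -
    have M': "subgroup M G" "M \<subseteq> R"
      using M by (auto simp: finite_index_subgroup_def Cent_def)
    note common = G commute \<open>l \<ge> 1\<close> R \<open>R \<subseteq> L\<close> L M'
    show ?thesis
      using Cent_eq_of_perfect[OF common RH(2) assms(14,15) g ind f perf]
        Cent_eq_of_perfect[OF common RH(1) assms(15,14) pairing_swap[OF g]
          induced_by_swap[OF commute ind] pairing_swap[OF f] perfect_swap[OF perf]]
      by blast
  qed
  have main: "Cent form l R L1 = L' \<and> Cent form l R L2 = L'"
    by (rule both) fact+
  then show ?thesis
    using both by blast
qed

end
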